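(* Let $1\le k\le n$, let $M:\mathbb{R}^n\times\mathbb{R}^n\to\mathbb{C}$ be a Mercer kernel such that $\operatorname{Dom}(\mathrm{O}_M)$ is dense in $L_2(\mathbb{R}^n)$, and let $f:\mathbb{R}^n\to\mathbb{C}$ satisfy $\operatorname{Tr}M_f<\infty$. Then $S_f\in\mathcal{B}(L_2^*(\mathbb{R}^n),\mathbb{R}^n)$ and $S_fS_f^\dagger=M_f$. Moreover, $$R(f)=\min_{S\in\mathcal{B}(L_2^*(\mathbb{R}^n),\mathbb{R}^n),\ \operatorname{rank}S\le k}\|S_f-S\|_*^2,$$ and the minimum is attained at $S=P_fS_f$, where $P_f=\sum_{i=1}^k\mathbf{u}_i\mathbf{u}_i^\dagger$ and $\mathbf{u}_1,\dots,\mathbf{u}_k$ are orthonormal eigenvectors of $M_f$ corresponding to its $k$ largest eigenvalues (counting multiplicities).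
   Context: $\langle u,v\rangle_{L_2}=\int u(\mathbf{x})^*v(\mathbf{x})\,d\mathbf{x}$. A Mercer kernel is a continuous function $M$ such that $[M(\mathbf{z}_i,\mathbf{z}_j)]_{i,j}$ is (Hermitian) positive semidefinite for every finite set of points. $\mathrm{O}_M[\phi](\mathbf{x})=\int_{\mathbb{R}^n}M(\mathbf{x},\mathbf{y})\phi(\mathbf{y})\,d\mathbf{y}$ with $\operatorname{Dom}(\mathrm{O}_M)=\{\phi\in L_2(\mathbb{R}^n):\mathrm{O}_M[\phi]\in L_2(\mathbb{R}^n)\}$; it is a positive operator, treated as self-adjoint when densely defined, and $\sqrt{\mathrm{O}_M}$ is its positive square root. $M_f=[\operatorname{Re}\langle x_if|M|x_jf\rangle]_{1\le i,j\le n}$, where $\langle f|M|g\rangle=\iint f(\mathbf{x})^*M(\mathbf{x},\mathbf{y})g(\mathbf{y})\,d\mathbf{x}\,d\mathbf{y}$. $R(f)=\|M_f\|_{n-k}$ is the sum of the $n-k$ smallest eigenvalues (with multiplicities) of $M_f$. $L_2^*(\mathbb{R}^n)$ is the real Hilbert space $L_2^r(\mathbb{R}^n)\times L_2^r(\mathbb{R}^n)$, where $L_2^r$ is the real-valued $L_2$ space; it is identified with the complex space $L_2(\mathbb{R}^n)$ viewed as a real vector space via $[\phi_1,\phi_2]\mapsto\phi_1+\mathrm{i}\phi_2$. $\mathcal{B}(H_1,H_2)$ is the set of bounded linear operators, and the rank of an operator is the dimension of its range. Every $O\in\mathcal{B}(L_2^*(\mathbb{R}^n),\mathbb{R}^n)$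 has the form $O[\phi]_i=\operatorname{Re}\langle O_i,\phi\rangle_{L_2}$ with $O_i\in L_2(\mathbb{R}^n)$, and $\|O\|_*=\big(\sum_{i=1}^n\|O_i\|_{L_2}^2\big)^{1/2}$ (Hilbert–Schmidt norm). $^\dagger$ denotes the adjoint. For $f$ with $\operatorname{Tr}M_f<\infty$, $S_f:L_2^*(\mathbb{R}^n)\to\mathbb{R}^n$ is defined by $S_f[\phi]_i=\operatorname{Re}\langle\sqrt{\mathrm{O}_M}[x_if(\mathbf{x})],\phi\rangle_{L_2}$, i.e. $(S_f)_i=\sqrt{\mathrm{O}_M}[x_if(\mathbf{x})]$, where the functions $\sqrt{\mathrm{O}_M}[x_if]$ are understood as elements of $L_2(\mathbb{R}^n)$ satisfying $\langle\sqrt{\mathrm{O}_M}[x_if],\sqrt{\mathrm{O}_M}[x_jf]\rangle_{L_2}=\langle x_if|M|x_jf\rangle$. *)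

theory Defs
  imports "HOL-Analysis.Analysis" "HOL-Computational_Algebra.Polynomial"
begin

section \<open>The space of square-integrable functions\<close>

definition square_integrable :: "('a::euclidean_space \<Rightarrow> complex) \<Rightarrow> bool" where
  "square_integrable u \<longleftrightarrow>
     u \<in> borel_measurable lebesgue \<and> integrable lebesgue (\<lambda>x. (norm (u x))\<^sup>2)"

definition l2_rel :: "('a::euclidean_space \<Rightarrow> complex) \<Rightarrow> ('a \<Rightarrow> complex) \<Rightarrow> bool" where
  "l2_rel u v \<longleftrightarrow>
     square_integrable u \<and> square_integrable v \<and> (AE x in lebesgue. u x = v x)"

lemma square_integrable_0 [simp]: "square_integrable (\<lambda>x. 0)"
  by (simp add: square_integrable_def)

lemma square_integrable_mult:
  assumes "square_integrable u"
  shows "square_integrable (\<lambda>x. c * u x)"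
  using assms by (auto simp: square_integrable_def norm_mult power_mult_distrib)

lemma square_integrable_uminus:
  assumes "square_integrable u"
  shows "square_integrable (\<lambda>x. - u x)"
  using assms by (auto simp: square_integrable_def)

lemma square_integrable_add:
  assumes u: "square_integrable u" and v: "square_integrable v"
  shows "square_integrable (\<lambda>x. u x + v x)"
proof -
  have m: "u \<in> borel_measurable lebesgue" "v \<in> borel_measurable lebesgue"
    using u v by (auto simp: square_integrable_def)
  have "integrable lebesgue (\<lambda>x. 2 * (norm (u x))\<^sup>2 + 2 * (norm (v x))\<^sup>2)"
    using u v by (auto simp: square_integrable_def)
  then have "integrable lebesgue (\<lambda>x. (norm (u x + v x))\<^sup>2)"
  proof (rule Bochner_Integration.integrable_bound)
    show "(\<lambda>x. (norm (u x + v x))\<^sup>2) \<in> borel_measurable lebesgue"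
      using m by measurable
    have "(norm (u x + v x))\<^sup>2 \<le> 2 * (norm (u x))\<^sup>2 + 2 * (norm (v x))\<^sup>2" for x
    proof -
      have "(norm (u x + v x))\<^sup>2 \<le> (norm (u x) + norm (v x))\<^sup>2"
        by (simp add: norm_triangle_ineq power_mono)
      also have "\<dots> \<le> 2 * (norm (u x))\<^sup>2 + 2 * (norm (v x))\<^sup>2"
        using sum_squares_bound[of "norm (u x)" "norm (v x)"] by (simp add: power2_sum)
      finally show ?thesis .
    qed
    then show "AE x in lebesgue. norm ((norm (u x + v x))\<^sup>2)
        \<le> norm (2 * (norm (u x))\<^sup>2 + 2 * (norm (v x))\<^sup>2)"
      by (intro AE_I2) auto
  qed
  then show ?thesis using m by (auto simp: square_integrable_def)
qed

lemma integrable_cnj_mult: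
  assumes u: "square_integrable u" and v: "square_integrable v"
  shows "integrable lebesgue (\<lambda>x. cnj (u x) * v x)"
proof -
  have m: "u \<in> borel_measurable lebesgue" "v \<in> borel_measurable lebesgue"
    using u v by (auto simp: square_integrable_def)
  have m': "(\<lambda>x. cnj (u x)) \<in> borel_measurable lebesgue"
    using measurable_compose[OF m(1) borel_measurable_continuous_onI[OF continuous_on_cnj[OF continuous_on_id]]]
    by simp
  have "integrable lebesgue (\<lambda>x. (norm (u x))\<^sup>2 + (norm (v x))\<^sup>2)"
    using u v by (auto simp: square_integrable_def)
  then show ?thesis
  proof (rule Bochner_Integration.integrable_bound)
    show "(\<lambda>x. cnj (u x) * v x) \<in> borel_measurable lebesgue"
      using m(2) m' by measurable
    have "norm (cnj (u x) * v x) \<le> (norm (u x))\<^sup>2 + (norm (v x))\<^sup>2" for x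
    proof -
      have "2 * (norm (u x) * norm (v x)) \<le> (norm (u x))\<^sup>2 + (norm (v x))\<^sup>2"
        using sum_squares_bound[of "norm (u x)" "norm (v x)"] by simp
      moreover have "0 \<le> norm (u x) * norm (v x)" by simp
      ultimately show ?thesis unfolding norm_mult complex_mod_cnj by linarith
    qed
    then show "AE x in lebesgue. norm (cnj (u x) * v x)
        \<le> norm ((norm (u x))\<^sup>2 + (norm (v x))\<^sup>2)"
      by (intro AE_I2) auto
  qed
qed

quotient_type (overloaded) 'a l2 = "'a::euclidean_space \<Rightarrow> complex" / partial: l2_rel
proof (rule part_equivpI)
  show "\<exists>u::'a \<Rightarrow> complex. l2_rel u u"
    by (rule exI[of _ "\<lambda>x. 0"]) (simp add: l2_rel_def)
  show "symp (l2_rel :: ('a \<Rightarrow> complex) \<Rightarrow> _)"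
    by (auto simp: symp_def l2_rel_def elim: AE_mp)
  show "transp (l2_rel :: ('a \<Rightarrow> complex) \<Rightarrow> _)"
    unfolding transp_def l2_rel_def by (auto elim: eventually_elim2)
qed

lift_definition l2_inner :: "'a::euclidean_space l2 \<Rightarrow> 'a l2 \<Rightarrow> complex"
  is "\<lambda>u v. \<integral>x. cnj (u x) * v x \<partial>lebesgue"
proof -
  fix u u' v v' :: "'a \<Rightarrow> complex"
  assume r: "l2_rel u u'" "l2_rel v v'"
  have e: "AE x in lebesgue. cnj (u x) * v x = cnj (u' x) * v' x"
    using r unfolding l2_rel_def by (auto elim: eventually_elim2)
  show "(\<integral>x. cnj (u x) * v x \<partial>lebesgue) = (\<integral>x. cnj (u' x) * v' x \<partial>lebesgue)"
    using e r unfolding l2_rel_def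
    by (intro integral_cong_AE borel_measurable_integrable integrable_cnj_mult) auto
qed

lift_definition l2_scaleC :: "complex \<Rightarrow> 'a::euclidean_space l2 \<Rightarrow> 'a l2"
  is "\<lambda>c u x. c * u x"
  unfolding l2_rel_def by (auto simp: square_integrable_mult elim: eventually_mono)

instantiation l2 :: (euclidean_space) real_vector
begin

lift_definition zero_l2 :: "'a l2" is "\<lambda>x. 0"
  by (simp add: l2_rel_def)

lift_definition plus_l2 :: "'a l2 \<Rightarrow> 'a l2 \<Rightarrow> 'a l2" is "\<lambda>u v x. u x + v x"
  unfolding l2_rel_def by (auto simp: square_integrable_add elim: eventually_elim2)

lift_definition uminus_l2 :: "'a l2 \<Rightarrow> 'a l2" is "\<lambda>u x. - u x"
  unfolding l2_rel_def by (auto simp: square_integrable_uminus elim: eventually_mono)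

definition minus_l2 :: "'a l2 \<Rightarrow> 'a l2 \<Rightarrow> 'a l2" where
  "minus_l2 \<phi> \<psi> = \<phi> + - \<psi>"

definition scaleR_l2 :: "real \<Rightarrow> 'a l2 \<Rightarrow> 'a l2" where
  "scaleR_l2 r = l2_scaleC (complex_of_real r)"

instance
proof
  fix a b c :: "'a l2" and r s :: real
  show "a + b + c = a + (b + c)"
    by transfer (auto simp: l2_rel_def algebra_simps square_integrable_add)
  show "a + b = b + a"
    by transfer (auto simp: l2_rel_def algebra_simps square_integrable_add)
  show "0 + a = a"
    by transfer (auto simp: l2_rel_def)
  show "- a + a = 0"
    by transfer (auto simp: l2_rel_def)
  show "a - b = a + - b"
    by (simp add: minus_l2_def)
  show "r *\<^sub>R (a + b) = r *\<^sub>R a + r *\<^sub>R b"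
    unfolding scaleR_l2_def
    by transfer (auto simp: l2_rel_def distrib_left intro!: square_integrable_add square_integrable_mult)
  show "(r + s) *\<^sub>R a = r *\<^sub>R a + s *\<^sub>R a"
    unfolding scaleR_l2_def of_real_add
    by transfer (auto simp: l2_rel_def distrib_right intro!: square_integrable_add square_integrable_mult)
  show "r *\<^sub>R s *\<^sub>R a = (r * s) *\<^sub>R a"
    unfolding scaleR_l2_def of_real_mult
    by transfer (auto simp: l2_rel_def mult.assoc intro!: square_integrable_mult)
  show "1 *\<^sub>R a = a"
    unfolding scaleR_l2_def of_real_1
    by transfer (auto simp: l2_rel_def)
qed

end

lemma l2_inner_add_left: "l2_inner (\<phi> + \<psi>) \<rho> = l2_inner \<phi> \<rho> + l2_inner \<psi> \<rho>"
  by transfer (simp add: l2_rel_def distrib_right integrable_cnj_mult)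

lemma l2_inner_scaleC_left: "l2_inner (l2_scaleC c \<phi>) \<psi> = cnj c * l2_inner \<phi> \<psi>"
  by transfer (simp add: l2_rel_def mult.assoc)

lemma l2_inner_cnj: "cnj (l2_inner \<phi> \<psi>) = l2_inner \<psi> \<phi>"
proof transfer
  fix u v :: "'a \<Rightarrow> complex"
  have "cnj (\<integral>x. cnj (u x) * v x \<partial>lebesgue) = (\<integral>x. cnj (cnj (u x) * v x) \<partial>lebesgue)"
    by (rule Bochner_Integration.integral_cnj[symmetric])
  then show "cnj (\<integral>x. cnj (u x) * v x \<partial>lebesgue) = (\<integral>x. cnj (v x) * u x \<partial>lebesgue)"
    by (simp add: mult.commute)
qed

lemma l2_inner_self: 
  "0 \<le> Re (l2_inner \<phi> \<phi>)" "Re (l2_inner \<phi> \<phi>) = 0 \<longleftrightarrow> \<phi> = 0"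
proof -
  have eq: "Re (\<integral>x. cnj (u x) * u x \<partial>lebesgue) = (\<integral>x. (norm (u x))\<^sup>2 \<partial>lebesgue)"
    for u :: "'a \<Rightarrow> complex"
  proof -
    have "(\<integral>x. cnj (u x) * u x \<partial>lebesgue) = (\<integral>x. complex_of_real ((norm (u x))\<^sup>2) \<partial>lebesgue)"
      by (simp only: complex_norm_square mult.commute)
    then show ?thesis by (simp only: integral_complex_of_real Re_complex_of_real)
  qed
  show "0 \<le> Re (l2_inner \<phi> \<phi>)"
    by transfer (simp add: eq)
  show "Re (l2_inner \<phi> \<phi>) = 0 \<longleftrightarrow> \<phi> = 0"
    by transfer (auto simp: eq l2_rel_def square_integrable_def integral_nonneg_eq_0_iff_AE)
qed

text \<open>The inner product is the real part of the complex one: with this instance the type is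
  \<open>L\<^sub>2\<close> regarded as a real Hilbert space, that is, \<open>L\<^sub>2\<^sup>*\<close> with \<open>[\<phi>\<^sub>1, \<phi>\<^sub>2]\<close> identified with
  \<open>\<phi>\<^sub>1 + \<i> \<phi>\<^sub>2\<close>.\<close>

instantiation l2 :: (euclidean_space) real_inner
begin

definition inner_l2 :: "'a l2 \<Rightarrow> 'a l2 \<Rightarrow> real" where
  "inner_l2 \<phi> \<psi> = Re (l2_inner \<phi> \<psi>)"

definition norm_l2 :: "'a l2 \<Rightarrow> real" where
  "norm_l2 \<phi> = sqrt (inner \<phi> \<phi>)"

definition sgn_l2 :: "'a l2 \<Rightarrow> 'a l2" where
  "sgn_l2 \<phi> = \<phi> /\<^sub>R norm \<phi>"

definition dist_l2 :: "'a l2 \<Rightarrow> 'a l2 \<Rightarrow> real" where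
  "dist_l2 \<phi> \<psi> = norm (\<phi> - \<psi>)"

definition uniformity_l2 :: "('a l2 \<times> 'a l2) filter" where
  "uniformity_l2 = (INF e\<in>{0 <..}. principal {(x, y). dist x y < e})"

definition open_l2 :: "'a l2 set \<Rightarrow> bool" where
  "open_l2 U \<longleftrightarrow> (\<forall>x\<in>U. eventually (\<lambda>(x', y). x' = x \<longrightarrow> y \<in> U) uniformity)"

instance
proof
  fix a b c :: "'a l2" and r :: real
  show "inner a b = inner b a"
    unfolding inner_l2_def by (subst l2_inner_cnj[symmetric]) simp
  show "inner (a + b) c = inner a c + inner b c"
    by (simp add: inner_l2_def l2_inner_add_left)
  show "inner (r *\<^sub>R a) b = r * inner a b"
    by (simp add: inner_l2_def scaleR_l2_def l2_inner_scaleC_left)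
  show "0 \<le> inner a a" "inner a a = 0 \<longleftrightarrow> a = 0"
    by (simp_all add: inner_l2_def l2_inner_self)
qed (simp_all add: norm_l2_def sgn_l2_def dist_l2_def uniformity_l2_def open_l2_def)

end


section \<open>Unbounded operators on the complex Hilbert space, given by their graphs\<close>

definition densely_defined :: "('a::euclidean_space l2 \<times> 'a l2) set \<Rightarrow> bool" where
  "densely_defined T \<longleftrightarrow> closure (Domain T) = UNIV"

definition adjoint_graph :: "('a::euclidean_space l2 \<times> 'a l2) set \<Rightarrow> ('a l2 \<times> 'a l2) set" where
  "adjoint_graph T = {(\<psi>, \<eta>). \<forall>(\<phi>, \<rho>)\<in>T. l2_inner \<psi> \<rho> = l2_inner \<eta> \<phi>}"

text \<open>The adjoint graph of a densely defined relation is the graph of a complex-linear operator,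
  so linearity and single-valuedness of \<open>T\<close> are part of the following condition.\<close>

definition self_adjoint :: "('a::euclidean_space l2 \<times> 'a l2) set \<Rightarrow> bool" where
  "self_adjoint T \<longleftrightarrow> densely_defined T \<and> adjoint_graph T = T"

definition positive_operator :: "('a::euclidean_space l2 \<times> 'a l2) set \<Rightarrow> bool" where
  "positive_operator T \<longleftrightarrow> 
     (\<forall>(\<phi>, \<rho>)\<in>T. Im (l2_inner \<phi> \<rho>) = 0 \<and> 0 \<le> Re (l2_inner \<phi> \<rho>))"

text \<open>A positive self-adjoint operator \<open>A\<close> has exactly one positive self-adjoint square root
  (\<open>T O T = A\<close> includes the equality of domains), and the union below is its graph. If \<open>A\<close> is not
  positive and self-adjoint, the union is empty.\<close>

definition sqrt_operator :: "('a::euclidean_space l2 \<times> 'a l2) set \<Rightarrow> ('a l2 \<times> 'a l2) set" where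
  "sqrt_operator A = \<Union> {T. self_adjoint T \<and> positive_operator T \<and> T O T = A}"


section \<open>Mercer kernels\<close>

definition hermitian_psd_on :: "'a set \<Rightarrow> ('a \<Rightarrow> 'a \<Rightarrow> complex) \<Rightarrow> bool" where
  "hermitian_psd_on Z A \<longleftrightarrow>
     (\<forall>x\<in>Z. \<forall>y\<in>Z. A y x = cnj (A x y)) \<and>
     (\<forall>c. 0 \<le> Re (\<Sum>x\<in>Z. \<Sum>y\<in>Z. cnj (c x) * A x y * c y))"

definition mercer_kernel :: "('a::euclidean_space \<Rightarrow> 'a \<Rightarrow> complex) \<Rightarrow> bool" where
  "mercer_kernel M \<longleftrightarrow>
     continuous_on UNIV (\<lambda>(x, y). M x y) \<and> (\<forall>Z. finite Z \<longrightarrow> hermitian_psd_on Z M)"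

definition kernel_apply ::
    "('a::euclidean_space \<Rightarrow> 'a \<Rightarrow> complex) \<Rightarrow> ('a \<Rightarrow> complex) \<Rightarrow> 'a \<Rightarrow> complex" where
  "kernel_apply M u x = (\<integral>y. M x y * u y \<partial>lebesgue)"

text \<open>Membership in the domain requires that the defining integral converges almost everywhere;
  without this, the value \<open>0\<close> of a divergent Bochner integral would enlarge the domain.\<close>

definition kernel_operator ::
    "('a::euclidean_space \<Rightarrow> 'a \<Rightarrow> complex) \<Rightarrow> ('a l2 \<times> 'a l2) set" where
  "kernel_operator M = {(abs_l2 u, abs_l2 v) | u v.
     square_integrable u \<and> square_integrable v \<and>
     (AE x in lebesgue. integrable lebesgue (\<lambda>y. M x y * u y) \<and> v x = kernel_apply M u x)}"

text \<open>The double integral \<open>\<langle>u|M|v\<rangle>\<close> is read as an iterated integral. By Fubini's theorem this is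
  the integral over the product space whenever the latter converges absolutely; the iterated one
  also covers \<open>\<langle>u, O\<^sub>M v\<rangle>\<close> for all square-integrable \<open>u\<close> and all \<open>v\<close> in the domain of \<open>O\<^sub>M\<close>.\<close>

definition kernel_form ::
    "('a::euclidean_space \<Rightarrow> 'a \<Rightarrow> complex) \<Rightarrow> ('a \<Rightarrow> complex) \<Rightarrow> ('a \<Rightarrow> complex) \<Rightarrow> complex" where
  "kernel_form M u v = (\<integral>x. cnj (u x) * kernel_apply M v x \<partial>lebesgue)"

definition kernel_form_converges ::
    "('a::euclidean_space \<Rightarrow> 'a \<Rightarrow> complex) \<Rightarrow> ('a \<Rightarrow> complex) \<Rightarrow> ('a \<Rightarrow> complex) \<Rightarrow> bool" where
  "kernel_form_converges M u v \<longleftrightarrow>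
     (AE x in lebesgue. u x \<noteq> 0 \<longrightarrow> integrable lebesgue (\<lambda>y. M x y * v y)) \<and>
     integrable lebesgue (\<lambda>x. cnj (u x) * kernel_apply M v x)"


section \<open>The matrix \<open>M\<^sub>f\<close> and the operator \<open>S\<^sub>f\<close>\<close>

definition coord_mult :: "'n::finite \<Rightarrow> (real^'n \<Rightarrow> complex) \<Rightarrow> real^'n \<Rightarrow> complex" where
  "coord_mult i f x = complex_of_real (x $ i) * f x"

definition kernel_matrix ::
    "(real^'n \<Rightarrow> real^'n \<Rightarrow> complex) \<Rightarrow> (real^'n::finite \<Rightarrow> complex) \<Rightarrow> real^'n^'n" where
  "kernel_matrix M f = (\<chi> i j. Re (kernel_form M (coord_mult i f) (coord_mult j f)))"

text \<open>\<open>Tr M\<^sub>f < \<infinity>\<close>: the integrals on the diagonal of \<open>M\<^sub>f\<close> converge.\<close>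

definition finite_trace ::
    "(real^'n \<Rightarrow> real^'n \<Rightarrow> complex) \<Rightarrow> (real^'n::finite \<Rightarrow> complex) \<Rightarrow> bool" where
  "finite_trace M f \<longleftrightarrow> (\<forall>i. kernel_form_converges M (coord_mult i f) (coord_mult i f))"

text \<open>The functions \<open>x\<^sub>i f\<close> need not lie in the domain of the square root of \<open>O\<^sub>M\<close>, nor be
  square-integrable. The functions \<open>\<surd>O\<^sub>M[x\<^sub>i f]\<close> are elements \<open>g i\<close> of \<open>L\<^sub>2\<close> whose inner products
  are \<open>\<langle>x\<^sub>i f|M|x\<^sub>j f\<rangle>\<close> and which are the values of the square root of \<open>O\<^sub>M\<close> wherever it is
  defined.\<close>

definition sqrt_kernel_family ::
    "(real^'n \<Rightarrow> real^'n \<Rightarrow> complex) \<Rightarrow> (real^'n::finite \<Rightarrow> complex) \<Rightarrow>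
     ('n \<Rightarrow> (real^'n) l2) \<Rightarrow> bool" where
  "sqrt_kernel_family M f g \<longleftrightarrow>
     (\<forall>i j. l2_inner (g i) (g j) = kernel_form M (coord_mult i f) (coord_mult j f)) \<and>
     (\<forall>i \<psi>. square_integrable (coord_mult i f) \<and>
        (abs_l2 (coord_mult i f), \<psi>) \<in> sqrt_operator (kernel_operator M) \<longrightarrow> g i = \<psi>)"

definition operator_of :: "('n::finite \<Rightarrow> 'a::euclidean_space l2) \<Rightarrow> 'a l2 \<Rightarrow> real^'n" where
  "operator_of g \<phi> = (\<chi> i. Re (l2_inner (g i) \<phi>))"

text \<open>For bounded linear \<open>S\<close> the representing functions exist and are unique (Riesz).\<close>

definition component :: "('a::euclidean_space l2 \<Rightarrow> real^'n::finite) \<Rightarrow> 'n \<Rightarrow> 'a l2" where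
  "component S i = (THE h. \<forall>\<phi>. S \<phi> $ i = Re (l2_inner h \<phi>))"

definition hs_norm :: "('a::euclidean_space l2 \<Rightarrow> real^'n::finite) \<Rightarrow> real" where
  "hs_norm S = sqrt (\<Sum>i\<in>UNIV. (norm (component S i))\<^sup>2)"


section \<open>Eigenvalues\<close>

definition charpoly :: "real^'n::finite^'n \<Rightarrow> real poly" where
  "charpoly A = det (\<chi> i j. (if i = j then [:0, 1:] else 0) - [:A $ i $ j:])"

text \<open>The real eigenvalues in increasing order, repeated according to their multiplicities as roots
  of the characteristic polynomial; for symmetric matrices there are \<open>CARD('n)\<close> of them.\<close>

definition eigenvalues :: "real^'n::finite^'n \<Rightarrow> real list" where
  "eigenvalues A = sorted_list_of_multiset (proots (charpoly A))"

definition sum_smallest_eigenvalues :: "nat \<Rightarrow> real^'n::finite^'n \<Rightarrow> real" where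
  "sum_smallest_eigenvalues m A = sum_list (take m (eigenvalues A))"

definition top_eigenvectors :: "nat \<Rightarrow> real^'n::finite^'n \<Rightarrow> (nat \<Rightarrow> real^'n) \<Rightarrow> bool" where
  "top_eigenvectors k A u \<longleftrightarrow>
     (\<forall>i<k. \<forall>j<k. u i \<bullet> u j = (if i = j then 1 else 0)) \<and>
     (\<forall>i<k. A *v u i = (rev (eigenvalues A) ! i) *\<^sub>R u i)"

definition eigenprojection :: "nat \<Rightarrow> (nat \<Rightarrow> real^'n::finite) \<Rightarrow> real^'n^'n" where
  "eigenprojection k u = (\<Sum>i<k. \<chi> a b. u i $ a * u i $ b)"

definition error_functional ::
    "(real^'n \<Rightarrow> real^'n \<Rightarrow> complex) \<Rightarrow> nat \<Rightarrow> (real^'n::finite \<Rightarrow> complex) \<Rightarrow> real" where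
  "error_functional M k f = sum_smallest_eigenvalues (CARD('n) - k) (kernel_matrix M f)"

end

theory Submission
  imports Defs
begin

text \<open>The theorem is an Eckart-Young theorem for the operator \<open>S\<^sub>f\<close> with rows \<open>g\<^sub>i\<close>. The assumption on the
inner products of the \<open>g\<^sub>i\<close> says that \<open>M\<^sub>f\<close> is their Gram matrix for the real inner product
(\<open>kernel_matrix_eq_gram_matrix\<close>), which turns the claims into statements about a finite family of vectors
in the real Hilbert space \<open>L\<^sub>2\<^sup>*\<close>. The adjoint of \<open>S\<^sub>f\<close> sends \<open>v\<close> to \<open>\<Sum>i. v\<^sub>i g\<^sub>i\<close>, whence \<open>S\<^sub>f S\<^sub>f\<^sup>\<dagger> = M\<^sub>f\<close> and
\<open>\<parallel>S\<^sub>f\<^sup>\<dagger> v\<parallel>\<^sup>2 = \<langle>v, M\<^sub>f v\<rangle>\<close>.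

Both halves of the minimisation rest on one Pythagorean identity (\<open>sum_norm_residual\<close>): for an orthonormal
family \<open>w\<close> in \<open>\<real>\<^sup>n\<close> and the orthogonal projection \<open>P\<close> onto its span,
\<open>\<parallel>H - P H\<parallel>\<^sub>*\<^sup>2 = \<parallel>H\<parallel>\<^sub>*\<^sup>2 - \<Sum>l. \<parallel>H\<^sup>\<dagger> w\<^sub>l\<parallel>\<^sup>2\<close>.

Upper bound: apply the identity to \<open>H = S\<^sub>f\<close> and to \<open>k\<close> top eigenvectors. Then
\<open>\<parallel>S\<^sub>f\<parallel>\<^sub>*\<^sup>2\<close> is the trace of \<open>M\<^sub>f\<close>, and the sum on the right consists of the \<open>k\<close> largest eigenvalues, so that
the \<open>n - k\<close> smallest remain (\<open>top_eigenvectors_residual\<close>).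

Lower bound: if \<open>S\<close> has rank at most \<open>k\<close>, let \<open>w\<close> consist of \<open>n - k\<close> orthonormal vectors orthogonal to the
range of \<open>S\<close>, and let \<open>H = S\<^sub>f - S\<close>. Since \<open>S\<^sup>\<dagger> w\<^sub>l = 0\<close>, the identity gives
\<open>\<parallel>S\<^sub>f - S\<parallel>\<^sub>*\<^sup>2 \<ge> \<Sum>l. \<langle>w\<^sub>l, M\<^sub>f w\<^sub>l\<rangle>\<close>, which by Ky Fan's minimum principle (\<open>ky_fan_lower_bound\<close>) is at least the
sum of the \<open>n - k\<close> smallest eigenvalues (\<open>hs_norm_lower_bound\<close>).

Two general facts are needed on the way. The Hilbert-Schmidt norm of an arbitrary bounded \<open>S\<close> is defined
through representing functions, whose existence is the Riesz representation theorem
(\<open>riesz_representation\<close>); it requires \<open>L\<^sub>2\<close> to be complete, which is proved by the Riesz-Fischer argument.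
The eigenvalues are defined as roots of the characteristic polynomial, and the spectral theorem matches them
with an orthonormal eigenbasis (\<open>symmetric_matrix_sorted_eigenbasis\<close>).\<close>

section \<open>Completeness of the space of square-integrable functions\<close>

lemma abs_l2_rep_l2: "abs_l2 (rep_l2 \<phi>) = \<phi>"
  by (rule Quotient3_abs_rep[OF Quotient3_l2])

lemma square_integrable_rep_l2: "square_integrable (rep_l2 \<phi>)"
  using Quotient3_rep_reflp[OF Quotient3_l2, of \<phi>] by (simp add: l2_rel_def)

lemma square_integrable_diff:
  assumes "square_integrable u" "square_integrable v"
  shows "square_integrable (\<lambda>x. u x - v x)"
  using square_integrable_add[OF assms(1) square_integrable_uminus[OF assms(2)]] by simp

lemma abs_l2_diff:
  assumes "square_integrable u" "square_integrable v"
  shows "abs_l2 u - abs_l2 v = abs_l2 (\<lambda>x. u x - v x)"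
  using assms square_integrable_uminus[OF assms(2)]
  by (simp add: minus_l2_def uminus_l2.abs_eq plus_l2.abs_eq l2_rel_def)

lemma nn_integral_norm_abs_l2:
  assumes "square_integrable u"
  shows "(\<integral>\<^sup>+x. ennreal ((norm (u x))\<^sup>2) \<partial>lebesgue) = ennreal ((norm (abs_l2 u))\<^sup>2)"
proof -
  have "(norm (abs_l2 u))\<^sup>2 = Re (\<integral>x. cnj (u x) * u x \<partial>lebesgue)"
    using assms
    by (simp add: power2_norm_eq_inner inner_l2_def l2_inner.abs_eq l2_rel_def)
  also have "(\<integral>x. cnj (u x) * u x \<partial>lebesgue)
      = (\<integral>x. complex_of_real ((norm (u x))\<^sup>2) \<partial>lebesgue)"
    by (simp only: complex_norm_square mult.commute)
  finally have "(norm (abs_l2 u))\<^sup>2 = (\<integral>x. (norm (u x))\<^sup>2 \<partial>lebesgue)"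
    by (simp only: integral_complex_of_real Re_complex_of_real)
  then show ?thesis
    using assms by (simp add: nn_integral_eq_integral square_integrable_def)
qed

text \<open>The weighted sum \<open>\<Sum>n. 2\<^sup>n \<bar>u\<^sub>n\<^sub>+\<^sub>1 - u\<^sub>n\<bar>\<^sup>2\<close> has a finite integral, at most \<open>\<Sum>n. 2\<^sup>n 4\<^sup>-\<^sup>n = 2\<close>, so it is
finite almost everywhere. Thanks to the weights, its finiteness at a point already makes the increments
themselves, and not only their squares, summable there.\<close>

lemma rapid_Cauchy_AE_convergent:
  fixes u :: "nat \<Rightarrow> 'a::euclidean_space \<Rightarrow> complex"
  assumes meas: "\<And>n. u n \<in> borel_measurable lebesgue"
    and rapid: "\<And>n. (\<integral>\<^sup>+x. ennreal ((norm (u (Suc n) x - u n x))\<^sup>2) \<partial>lebesgue)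
                  \<le> ennreal ((1/4) ^ n)"
  shows "AE x in lebesgue. convergent (\<lambda>n. u n x)"
proof -
  define \<delta> where "\<delta> n x = 2 ^ n * (norm (u (Suc n) x - u n x))\<^sup>2" for n x
  have \<delta>_meas: "(\<lambda>x. ennreal (\<delta> n x)) \<in> borel_measurable lebesgue" for n
    using meas unfolding \<delta>_def by measurable
  have "(\<integral>\<^sup>+x. (\<Sum>n. ennreal (\<delta> n x)) \<partial>lebesgue) = (\<Sum>n. \<integral>\<^sup>+x. ennreal (\<delta> n x) \<partial>lebesgue)"
    by (rule nn_integral_suminf[OF \<delta>_meas])
  also have "\<dots> \<le> (\<Sum>n. ennreal ((1/2) ^ n))"
  proof (rule suminf_le)
    fix n
    have "(\<integral>\<^sup>+x. ennreal (\<delta> n x) \<partial>lebesgue)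
        = ennreal (2 ^ n) * (\<integral>\<^sup>+x. ennreal ((norm (u (Suc n) x - u n x))\<^sup>2) \<partial>lebesgue)"
      unfolding \<delta>_def using meas by (subst nn_integral_cmult[symmetric]) (auto simp: ennreal_mult)
    also have "\<dots> \<le> ennreal (2 ^ n) * ennreal ((1/4) ^ n)"
      by (intro mult_left_mono rapid) simp
    also have "\<dots> = ennreal ((1/2) ^ n)"
      by (simp add: ennreal_mult[symmetric] power_mult_distrib[symmetric])
    finally show "(\<integral>\<^sup>+x. ennreal (\<delta> n x) \<partial>lebesgue) \<le> ennreal ((1/2) ^ n)" .
  qed simp_all
  also have "\<dots> = ennreal 2"
    by (simp add: suminf_ennreal2 suminf_geometric)
  finally have "(\<integral>\<^sup>+x. (\<Sum>n. ennreal (\<delta> n x)) \<partial>lebesgue) \<noteq> \<infinity>"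
    using ennreal_less_top neq_top_trans by (auto simp: top_unique)
  then have "AE x in lebesgue. (\<Sum>n. ennreal (\<delta> n x)) \<noteq> \<infinity>"
    by (intro nn_integral_PInf_AE) (use \<delta>_meas in measurable)
  then show ?thesis
  proof eventually_elim
    fix x
    assume "(\<Sum>n. ennreal (\<delta> n x)) \<noteq> \<infinity>"
    then have "summable (\<lambda>n. \<delta> n x)"
      by (intro summable_suminf_not_top) (auto simp: \<delta>_def)
    then have "summable (\<lambda>n. \<delta> n x + (1/2) ^ n)"
      by (intro summable_add summable_geometric) simp_all
    then have "summable (\<lambda>n. u (Suc n) x - u n x)"
    proof (rule summable_comparison_test')
      fix n
      let ?d = "norm (u (Suc n) x - u n x)"
      \<comment> \<open>Arithmetic-geometric mean: \<open>2d \<le> 2\<^sup>n d\<^sup>2 + 2\<^sup>-\<^sup>n\<close>.\<close>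
      have "0 \<le> 2 ^ n * (?d - (1/2) ^ n)\<^sup>2"
        by simp
      also have "\<dots> = \<delta> n x - 2 * ?d * (2 ^ n * (1/2) ^ n) + (2 ^ n * (1/2) ^ n) * (1/2) ^ n"
        by (simp only: \<delta>_def power2_diff) (simp add: algebra_simps power2_eq_square)
      also have "(2::real) ^ n * (1/2) ^ n = 1"
        by (simp add: power_mult_distrib[symmetric])
      finally have "2 * ?d \<le> \<delta> n x + (1/2) ^ n"
        by simp
      then show "?d \<le> \<delta> n x + (1/2) ^ n"
        using norm_ge_zero[of "u (Suc n) x - u n x"] by linarith
    qed
    then have "convergent (\<lambda>n. \<Sum>i<n. u (Suc i) x - u i x)"
      by (simp add: summable_iff_convergent)
    then have "convergent (\<lambda>n. (u n x - u 0 x) + u 0 x)"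
      by (intro convergent_add convergent_const) (simp only: sum_lessThan_telescope[where f = "\<lambda>i. u i x"])
    then show "convergent (\<lambda>n. u n x)"
      by simp
  qed
qed

text \<open>The limit is the pointwise almost-everywhere limit of representatives. Fatou's lemma shows both that
it is square-integrable and that the sequence converges to it in norm.\<close>

lemma rapid_Cauchy_l2_convergent:
  fixes Y :: "nat \<Rightarrow> 'a::euclidean_space l2"
  assumes rapid: "\<And>m n. m \<le> n \<Longrightarrow> norm (Y n - Y m) \<le> (1/2) ^ m"
  shows "convergent Y"
proof -
  define u where "u n = rep_l2 (Y n)" for n
  have u: "square_integrable (u n)" and Y: "Y n = abs_l2 (u n)" for n
    by (simp_all add: u_def square_integrable_rep_l2 abs_l2_rep_l2)
  have meas: "u n \<in> borel_measurable lebesgue" for n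
    using u by (simp add: square_integrable_def)
  have dist_u: "(\<integral>\<^sup>+x. ennreal ((norm (u n x - u m x))\<^sup>2) \<partial>lebesgue) \<le> ennreal ((1/4) ^ m)"
    if "m \<le> n" for m n
  proof -
    have "(norm (Y n - Y m))\<^sup>2 \<le> ((1/2) ^ m)\<^sup>2"
      using rapid[OF that] by (intro power_mono) auto
    also have "\<dots> = (1/4) ^ m"
      by (simp add: power_mult[symmetric] mult.commute[of m])
         (simp add: power_mult power2_eq_square)
    finally show ?thesis
      using nn_integral_norm_abs_l2[OF square_integrable_diff[OF u u], of n m]
      by (simp add: Y abs_l2_diff u ennreal_leI)
  qed
  have conv: "AE x in lebesgue. convergent (\<lambda>n. u n x)"
    by (rule rapid_Cauchy_AE_convergent[OF meas dist_u]) simp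
  define v where "v x = lim (\<lambda>n. u n x)" for x
  have v_meas: "v \<in> borel_measurable lebesgue"
    unfolding v_def by (intro borel_measurable_lim_metric meas)
  \<comment> \<open>Fatou's lemma turns the bounds on \<open>u n - u m\<close> into the same bounds on \<open>v - u m\<close>.\<close>
  have dist_v: "(\<integral>\<^sup>+x. ennreal ((norm (v x - u m x))\<^sup>2) \<partial>lebesgue) \<le> ennreal ((1/4) ^ m)" for m
  proof -
    have "(\<integral>\<^sup>+x. ennreal ((norm (v x - u m x))\<^sup>2) \<partial>lebesgue)
        = (\<integral>\<^sup>+x. liminf (\<lambda>n. ennreal ((norm (u n x - u m x))\<^sup>2)) \<partial>lebesgue)"
    proof (rule nn_integral_cong_AE, use conv in eventually_elim)
      fix x
      assume "convergent (\<lambda>n. u n x)"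
      then have "(\<lambda>n. u n x) \<longlonglongrightarrow> v x"
        by (simp add: v_def convergent_LIMSEQ_iff)
      then have "(\<lambda>n. ennreal ((norm (u n x - u m x))\<^sup>2)) \<longlonglongrightarrow> ennreal ((norm (v x - u m x))\<^sup>2)"
        by (intro tendsto_intros)
      then show "ennreal ((norm (v x - u m x))\<^sup>2)
          = liminf (\<lambda>n. ennreal ((norm (u n x - u m x))\<^sup>2))"
        by (intro lim_imp_Liminf[symmetric]) simp_all
    qed
    also have "\<dots> \<le> liminf (\<lambda>n. \<integral>\<^sup>+x. ennreal ((norm (u n x - u m x))\<^sup>2) \<partial>lebesgue)"
      by (intro nn_integral_liminf) (use meas in measurable)
    also have "\<dots> \<le> ennreal ((1/4) ^ m)"
      by (intro Liminf_le eventually_sequentiallyI[of m] dist_u) simp_all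
    finally show ?thesis .
  qed
  have diff: "square_integrable (\<lambda>x. v x - u m x)" for m
    unfolding square_integrable_def
  proof
    show "(\<lambda>x. v x - u m x) \<in> borel_measurable lebesgue"
      using v_meas meas by measurable
    show "integrable lebesgue (\<lambda>x. (norm (v x - u m x))\<^sup>2)"
      using v_meas meas dist_v[of m]
      by (intro integrableI_nonneg) (auto intro: le_less_trans)
  qed
  have v: "square_integrable v"
    using square_integrable_add[OF diff[of 0] u[of 0]] by simp
  have bound: "(norm (Y m - abs_l2 v))\<^sup>2 \<le> (1/4) ^ m" for m
    using dist_v[of m] nn_integral_norm_abs_l2[OF diff[of m]]
    by (subst norm_minus_commute) (simp add: Y abs_l2_diff u v)
  have "(\<lambda>m. (norm (Y m - abs_l2 v))\<^sup>2) \<longlonglongrightarrow> 0"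
    by (rule tendsto_sandwich[of "\<lambda>_. 0" _ _ "\<lambda>m. (1/4) ^ m"])
       (auto simp: bound intro!: LIMSEQ_power_zero)
  then have "(\<lambda>m. sqrt ((norm (Y m - abs_l2 v))\<^sup>2)) \<longlonglongrightarrow> sqrt 0"
    by (rule tendsto_real_sqrt)
  then have "Y \<longlonglongrightarrow> abs_l2 v"
    by (simp add: tendsto_norm_zero_iff LIM_zero_iff)
  then show ?thesis
    by (rule convergentI)
qed

text \<open>A Cauchy sequence converges as soon as a subsequence does, and a subsequence can be chosen so that its
terms approach each other at the geometric rate required above.\<close>

instance l2 :: (euclidean_space) complete_space
proof
  fix X :: "nat \<Rightarrow> 'a l2"
  assume X: "Cauchy X"
  have "\<exists>r. strict_mono r \<and> (\<forall>n. \<forall>i\<ge>r n. \<forall>j\<ge>r n. norm (X i - X j) < (1/2) ^ n)"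
  proof -
    have "\<exists>N. \<forall>i\<ge>N. \<forall>j\<ge>N. norm (X i - X j) < (1/2) ^ n" for n
      using CauchyD[OF X, of "(1/2) ^ n"] by simp
    then obtain N where N: "\<And>n i j. N n \<le> i \<Longrightarrow> N n \<le> j \<Longrightarrow> norm (X i - X j) < (1/2) ^ n"
      by metis
    define r where "r n = n + (\<Sum>i\<le>n. N i)" for n
    have "strict_mono r"
      by (simp add: strict_mono_Suc_iff r_def)
    moreover have "N n \<le> r n" for n
      unfolding r_def by (simp add: member_le_sum trans_le_add2)
    ultimately show ?thesis
      using N by (meson order_trans)
  qed
  then obtain r where r: "strict_mono r"
    and close: "\<And>n i j. r n \<le> i \<Longrightarrow> r n \<le> j \<Longrightarrow> norm (X i - X j) < (1/2) ^ n"
    by blast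
  have "convergent (\<lambda>n. X (r n))"
    using strict_mono_less_eq[OF r]
    by (intro rapid_Cauchy_l2_convergent) (rule less_imp_le, rule close, simp_all)
  then obtain L where "(\<lambda>n. X (r n)) \<longlonglongrightarrow> L"
    by (auto simp: convergent_def)
  then have "X \<longlonglongrightarrow> L"
    by (intro Cauchy_converges_subseq[OF X r]) (simp add: o_def)
  then show "convergent X"
    by (rule convergentI)
qed

section \<open>Riesz representation\<close>

text \<open>The first-order condition at a minimum: the value changes by \<open>2tb + t\<^sup>2c\<close> along a line through a
minimiser. It serves both the minimisation behind the Riesz representation and the extremal
characterisation of an eigenvector.\<close>

lemma quadratic_nonneg_imp_linear_zero:
  fixes b c :: real
  assumes "\<And>t. 0 \<le> 2 * t * b + t\<^sup>2 * c"
  shows "b = 0"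
proof (rule ccontr)
  assume "b \<noteq> 0"
  define d where "d = 1 + \<bar>c\<bar>"
  then have "0 < d"
    by simp
  have "0 \<le> (2 * (- b / d) * b + (- b / d)\<^sup>2 * c) * d\<^sup>2"
    by (intro mult_nonneg_nonneg assms) simp
  also have "\<dots> = b\<^sup>2 * (c - 2 * d)"
    using \<open>0 < d\<close> by (simp add: field_simps power2_eq_square)
  finally have "0 \<le> c - 2 * d"
    using \<open>b \<noteq> 0\<close> by (simp add: zero_le_mult_iff)
  then show False
    unfolding d_def by simp
qed

text \<open>The representing vector is the minimiser of \<open>J(x) = \<parallel>x\<parallel>\<^sup>2 - 2 L(x)\<close>: the derivative of \<open>J\<close> at \<open>h\<close> in
direction \<open>\<phi>\<close> is \<open>2 (\<langle>h, \<phi>\<rangle> - L \<phi>)\<close>. Completeness gives the existence of the minimiser, since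
minimising sequences are Cauchy by the parallelogram law.\<close>

theorem riesz_representation:
  fixes L :: "'h::{real_inner, complete_space} \<Rightarrow> real"
  assumes "bounded_linear L"
  obtains h where "\<And>\<phi>. L \<phi> = inner h \<phi>"
proof -
  interpret L: bounded_linear L by fact
  define J where "J x = inner x x - 2 * L x" for x
  obtain B where B: "\<And>x. norm (L x) \<le> norm x * B"
    using L.bounded by blast
  have "- B\<^sup>2 \<le> J x" for x
  proof -
    have "2 * L x \<le> 2 * (norm x * B)"
      using B[of x] by simp
    moreover have "0 \<le> (norm x - B)\<^sup>2"
      by simp
    ultimately show ?thesis
      unfolding J_def power2_norm_eq_inner[symmetric] by (simp add: power2_diff)
  qed
  then have bdd: "bdd_below (range J)"
    by (intro bdd_belowI2)
  define m where "m = (INF x. J x)"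
  have m_le: "m \<le> J x" for x
    unfolding m_def by (rule cINF_lower[OF bdd]) simp
  have "\<exists>x. J x < m + 1 / Suc n" for n
    using cINF_less_iff[OF _ bdd, of "m + 1 / Suc n"] by (simp add: m_def)
  then obtain X where X: "\<And>n. J (X n) < m + 1 / Suc n"
    by metis
  \<comment> \<open>Parallelogram law: the midpoint of two almost minimal points is no better than minimal,
    so the points are close to each other.\<close>
  have close: "(norm (X i - X j))\<^sup>2 \<le> 2 / Suc i + 2 / Suc j" for i j
  proof -
    have "(norm (X i - X j))\<^sup>2 = 2 * J (X i) + 2 * J (X j) - 4 * J ((1/2) *\<^sub>R (X i + X j))"
      unfolding J_def power2_norm_eq_inner
      by (simp add: L.add L.scaleR inner_simps inner_commute[of "X j" "X i"] field_simps)
    then show ?thesis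
      using X[of i] X[of j] m_le[of "(1/2) *\<^sub>R (X i + X j)"] by simp
  qed
  have "Cauchy X"
  proof (rule CauchyI)
    fix e :: real
    assume "0 < e"
    then obtain N where N: "inverse (Suc N) < e\<^sup>2 / 4"
      using reals_Archimedean[of "e\<^sup>2 / 4"] by auto
    have "norm (X i - X j) < e" if "N \<le> i" "N \<le> j" for i j
    proof -
      have "1 / Suc i \<le> inverse (Suc N)" "1 / Suc j \<le> inverse (Suc N)"
        using that by (simp_all add: field_simps)
      then have "(norm (X i - X j))\<^sup>2 < e\<^sup>2"
        using close[of i j] N by simp
      then show ?thesis
        using \<open>0 < e\<close> by (simp add: power_less_imp_less_base)
    qed
    then show "\<exists>N. \<forall>i\<ge>N. \<forall>j\<ge>N. norm (X i - X j) < e"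
      by blast
  qed
  then obtain h where h: "X \<longlonglongrightarrow> h"
    using Cauchy_convergent convergent_def by blast
  have "(\<lambda>n. J (X n)) \<longlonglongrightarrow> J h"
    unfolding J_def by (intro tendsto_intros h L.tendsto)
  moreover have "(\<lambda>n. m + 1 / Suc n) \<longlonglongrightarrow> m + 0"
    by (intro tendsto_intros LIMSEQ_Suc[OF lim_1_over_n])
  ultimately have "J h \<le> m"
    using X by (auto intro: LIMSEQ_le less_imp_le)
  have "inner h \<phi> - L \<phi> = 0" for \<phi>
  proof (rule quadratic_nonneg_imp_linear_zero)
    fix t :: real
    have "J h \<le> J (h + t *\<^sub>R \<phi>)"
      using \<open>J h \<le> m\<close> m_le by (rule order_trans)
    then show "0 \<le> 2 * t * (inner h \<phi> - L \<phi>) + t\<^sup>2 * inner \<phi> \<phi>"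
      unfolding J_def
      by (simp add: L.add L.scaleR inner_simps inner_commute[of \<phi> h] algebra_simps power2_eq_square)
  qed
  then show thesis
    by (intro that[of h]) simp
qed

section \<open>Orthonormal families\<close>

definition orthonormal_family :: "'i set \<Rightarrow> ('i \<Rightarrow> 'h::real_inner) \<Rightarrow> bool" where
  "orthonormal_family I w \<longleftrightarrow> (\<forall>i\<in>I. \<forall>j\<in>I. inner (w i) (w j) = (if i = j then 1 else 0))"

lemma orthonormal_familyD:
  "orthonormal_family I w \<Longrightarrow> i \<in> I \<Longrightarrow> j \<in> I \<Longrightarrow> inner (w i) (w j) = (if i = j then 1 else 0)"
  by (simp add: orthonormal_family_def)

lemma orthonormal_family_reindex:
  assumes "orthonormal_family I w" and "inj_on p J" and "p ` J \<subseteq> I"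
  shows "orthonormal_family J (\<lambda>j. w (p j))"
  using assms unfolding orthonormal_family_def inj_on_def
  by (metis imageI subsetD)

lemma orthonormal_family_in_subspace:
  fixes W :: "'a::euclidean_space set"
  assumes "subspace W" and "m \<le> dim W"
  obtains w where "orthonormal_family {..<m} w" and "\<And>i. i < m \<Longrightarrow> w i \<in> W"
proof -
  obtain B where B: "B \<subseteq> W" "pairwise orthogonal B" "\<And>x. x \<in> B \<Longrightarrow> norm x = 1"
    "independent B" "card B = dim W"
    using orthonormal_basis_subspace[OF assms(1)] by metis
  have "finite B"
    using B(4) by (rule independent_imp_finite)
  then obtain b where "bij_betw b {0..<card B} B"
    using ex_bij_betw_nat_finite by blast
  then have "inj_on b {..<m}" "b ` {..<m} \<subseteq> B"
    using assms(2) B(5)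
    by (auto simp: bij_betw_def intro: inj_on_subset)
  moreover have "orthonormal_family B (\<lambda>x. x)"
    using B(2,3) by (auto simp: orthonormal_family_def pairwise_def orthogonal_def norm_eq_1)
  ultimately show thesis
    using B(1) by (intro that[of b]) (auto dest: orthonormal_family_reindex)
qed

text \<open>As many orthonormal vectors as the dimension span the space, so the difference of the two sides is
orthogonal to everything, including itself.\<close>

lemma orthonormal_family_expansion:
  fixes e :: "nat \<Rightarrow> 'a::euclidean_space"
  assumes e: "orthonormal_family {..<DIM('a)} e"
  shows "(\<Sum>i<DIM('a). inner x (e i) *\<^sub>R e i) = x"
proof -
  let ?B = "e ` {..<DIM('a)}" and ?y = "x - (\<Sum>i<DIM('a). inner x (e i) *\<^sub>R e i)"
  have inj: "inj_on e {..<DIM('a)}"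
    by (rule inj_onI) (metis e orthonormal_familyD zero_neq_one)
  have orth: "pairwise orthogonal ?B"
    using e by (auto simp: pairwise_def orthogonal_def orthonormal_familyD)
  have "0 \<notin> ?B"
    using orthonormal_familyD[OF e] by fastforce
  then have "independent ?B"
    using pairwise_orthogonal_independent[OF orth] by simp
  then have span: "span ?B = UNIV"
    using card_image[OF inj] card_eq_dim[of ?B UNIV] by auto
  have "inner ?y (e j) = 0" if "j < DIM('a)" for j
    using that
    by (simp add: inner_diff_left inner_sum_left orthonormal_familyD[OF e] if_distrib cong: if_cong)
  then have "orthogonal ?y ?y"
    using orthogonal_to_span[of ?y ?B ?y] by (auto simp: span orthogonal_def)
  then show ?thesis
    by (simp add: orthogonal_self)
qed

lemma orthonormal_family_parseval:
  fixes e :: "nat \<Rightarrow> 'a::euclidean_space"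
  assumes "orthonormal_family {..<DIM('a)} e"
  shows "(\<Sum>i<DIM('a). (inner x (e i))\<^sup>2) = inner x x"
proof -
  have "inner x x = inner x (\<Sum>i<DIM('a). inner x (e i) *\<^sub>R e i)"
    by (simp only: orthonormal_family_expansion[OF assms])
  then show ?thesis
    by (simp add: inner_sum_right power2_eq_square)
qed

lemma bessel_inequality:
  assumes "finite I" and w: "orthonormal_family I w"
  shows "(\<Sum>i\<in>I. (inner x (w i))\<^sup>2) \<le> inner x x"
proof -
  let ?p = "\<Sum>i\<in>I. inner x (w i) *\<^sub>R w i"
  have px: "inner x ?p = (\<Sum>i\<in>I. (inner x (w i))\<^sup>2)"
    by (simp add: inner_sum_right power2_eq_square)
  have "inner (w i) ?p = inner x (w i)" if "i \<in> I" for i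
    using that assms
    by (simp add: inner_sum_right orthonormal_familyD[OF w] if_distrib sum.delta cong: if_cong)
  then have "inner ?p ?p = (\<Sum>i\<in>I. (inner x (w i))\<^sup>2)"
    by (simp add: inner_sum_left power2_eq_square)
  moreover have "0 \<le> inner (x - ?p) (x - ?p)"
    by (rule inner_ge_zero)
  ultimately show ?thesis
    using px by (simp add: inner_diff_left inner_diff_right inner_commute[of ?p x])
qed

section \<open>The spectral theorem for symmetric matrices\<close>

text \<open>A unit vector of \<open>W\<close> at which \<open>\<langle>x, T x\<rangle>\<close> is largest is an eigenvector. With \<open>\<mu>\<close> the maximal value, the
quadratic form \<open>q(y) = \<mu> \<parallel>y\<parallel>\<^sup>2 - \<langle>y, T y\<rangle>\<close> is nonnegative on \<open>W\<close> and vanishes at \<open>x\<close>, so its derivative at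
\<open>x\<close> vanishes in every direction of \<open>W\<close>; invariance allows the direction \<open>\<mu> x - T x\<close>.\<close>

lemma selfadjoint_eigenvector_in_invariant_subspace:
  fixes T :: "'a::euclidean_space \<Rightarrow> 'a"
  assumes T: "linear T" and sym: "\<And>x y. inner (T x) y = inner x (T y)"
    and W: "subspace W" and invariant: "\<And>x. x \<in> W \<Longrightarrow> T x \<in> W" and "W \<noteq> {0}"
  obtains x \<mu> where "x \<in> W" and "inner x x = 1" and "T x = \<mu> *\<^sub>R x"
proof -
  interpret T: linear T by fact
  obtain z where z: "z \<in> W" "z \<noteq> 0"
    using \<open>W \<noteq> {0}\<close> subspace_0[OF W] by blast
  define K where "K = W \<inter> sphere 0 1"
  have "z /\<^sub>R norm z \<in> K"
    using z by (simp add: K_def subspace_scale[OF W])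
  moreover have "compact K"
    unfolding K_def by (intro closed_Int_compact closed_subspace W compact_sphere)
  moreover have "continuous_on K (\<lambda>x. inner x (T x))"
    by (intro continuous_intros linear_continuous_on_compose[OF _ T]) 
  ultimately obtain x where x: "x \<in> K" and x_max: "\<And>y. y \<in> K \<Longrightarrow> inner y (T y) \<le> inner x (T x)"
    using continuous_attains_sup[of K "\<lambda>x. inner x (T x)"] by blast
  define \<mu> where "\<mu> = inner x (T x)"
  have xW: "x \<in> W" and xx: "inner x x = 1"
    using x by (auto simp: K_def norm_eq_1)
  define q where "q y = \<mu> * inner y y - inner y (T y)" for y
  have q_nonneg: "0 \<le> q y" if "y \<in> W" for y
  proof (cases "y = 0")
    case False
    have "y /\<^sub>R norm y \<in> K"
      using that False by (simp add: K_def subspace_scale[OF W])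
    from x_max[OF this] have "inner y (T y) / (norm y)\<^sup>2 \<le> \<mu>"
      by (simp add: \<mu>_def T.scaleR field_simps power2_eq_square)
    then show ?thesis
      using False by (simp add: q_def power2_norm_eq_inner[symmetric] field_simps)
  qed (simp add: q_def)
  define d where "d = \<mu> *\<^sub>R x - T x"
  have dW: "d \<in> W"
    unfolding d_def by (intro subspace_diff W subspace_scale invariant xW)
  have "inner d d = 0"
  proof (rule quadratic_nonneg_imp_linear_zero)
    fix t :: real
    have "0 \<le> q (x + t *\<^sub>R d)"
      by (intro q_nonneg subspace_add W subspace_scale xW dW)
    also have "q (x + t *\<^sub>R d) = 2 * t * inner (\<mu> *\<^sub>R x - T x) d + t\<^sup>2 * q d"
      using sym[of x d]
      by (simp add: q_def T.add T.scaleR inner_simps inner_commute[of d x] inner_commute[of d "T x"]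
          xx \<mu>_def[symmetric] algebra_simps power2_eq_square)
    finally show "0 \<le> 2 * t * inner d d + t\<^sup>2 * q d"
      by (simp only: d_def)
  qed
  then have "T x = \<mu> *\<^sub>R x"
    by (simp add: d_def)
  then show thesis
    by (rule that[OF xW xx])
qed

text \<open>The orthogonal complement of the eigenvectors already found is invariant under \<open>T\<close>, because \<open>T\<close> is
self-adjoint, and so contains the next one.\<close>

lemma selfadjoint_orthonormal_eigenvectors:
  fixes T :: "'a::euclidean_space \<Rightarrow> 'a"
  assumes T: "linear T" and sym: "\<And>x y. inner (T x) y = inner x (T y)"
    and "m \<le> DIM('a)"
  shows "\<exists>e \<mu>. orthonormal_family {..<m} e \<and> (\<forall>i<m. T (e i) = \<mu> i *\<^sub>R e i)"
  using \<open>m \<le> DIM('a)\<close>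
proof (induction m)
  case 0
  then show ?case by (simp add: orthonormal_family_def)
next
  case (Suc m)
  then obtain e \<mu> where e: "orthonormal_family {..<m} e" and \<mu>: "\<And>i. i < m \<Longrightarrow> T (e i) = \<mu> i *\<^sub>R e i"
    by auto
  define W where "W = {x. \<forall>b\<in>e ` {..<m}. orthogonal b x}"
  have W: "subspace W"
    unfolding W_def by (rule subspace_orthogonal_to_vectors)
  have W_iff: "x \<in> W \<longleftrightarrow> (\<forall>i<m. inner (e i) x = 0)" for x
    by (auto simp: W_def orthogonal_def)
  have invariant: "T x \<in> W" if "x \<in> W" for x
    using that by (simp add: W_iff \<mu> sym[symmetric])
  have "W \<noteq> {0}"
  proof -
    have "dim (e ` {..<m}) < DIM('a)"
      using Suc.prems dim_le_card'[of "e ` {..<m}"] card_image_le[of "{..<m}" e] by simp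
    then obtain x where "x \<noteq> 0" and x: "\<And>y. y \<in> span (e ` {..<m}) \<Longrightarrow> orthogonal x y"
      by (rule orthogonal_to_subspace_exists) blast
    have "orthogonal b x" if "b \<in> e ` {..<m}" for b
      using x[OF span_base[OF that]] by (simp add: orthogonal_commute)
    then have "x \<in> W"
      by (simp add: W_def)
    with \<open>x \<noteq> 0\<close> show ?thesis
      by blast
  qed
  then obtain x \<nu> where x: "x \<in> W" "inner x x = 1" "T x = \<nu> *\<^sub>R x"
    using selfadjoint_eigenvector_in_invariant_subspace[OF T sym W invariant] by blast
  have perp: "inner (e i) x = 0" "inner x (e i) = 0" if "i < m" for i
    using x(1) that by (simp_all add: W_iff inner_commute[of x])
  have "orthonormal_family {..<Suc m} (e(m := x))"
    unfolding orthonormal_family_def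
  proof (intro ballI)
    fix i j
    assume "i \<in> {..<Suc m}" "j \<in> {..<Suc m}"
    then show "inner ((e(m := x)) i) ((e(m := x)) j) = (if i = j then 1 else 0)"
      by (cases "i = m"; cases "j = m") (simp_all add: perp x(2) orthonormal_familyD[OF e])
  qed
  moreover have "\<forall>i<Suc m. T ((e(m := x)) i) = (\<mu>(m := \<nu>)) i *\<^sub>R (e(m := x)) i"
    using \<mu> x(3) by (simp add: less_Suc_eq)
  ultimately show ?case
    by blast
qed

lemma poly_charpoly:
  "poly (charpoly A) x = det (\<chi> i j. (if i = j then x else 0) - A $ i $ j)"
  unfolding charpoly_def det_def
  by (simp add: poly_sum poly_prod if_distrib[where f = "\<lambda>p. poly p x"] cong: if_cong)

text \<open>Links eigenvalues given by eigenvectors with those defined as roots of the characteristic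
polynomial. Evaluating that polynomial at a number \<open>x\<close> avoids determinants over the polynomial ring: the real
matrix \<open>x I - A\<close> is diagonalised by the matrix \<open>E\<close> of the eigenvectors.\<close>

lemma proots_charpoly_orthonormal_eigenbasis:
  fixes A :: "real^'n::finite^'n"
  assumes e: "orthonormal_family UNIV e" and eig: "\<And>i::'n. A *v e i = \<mu> i *\<^sub>R e i"
  shows "proots (charpoly A) = image_mset \<mu> (mset_set UNIV)"
proof -
  define E where "E = (\<chi> i j. e j $ i)"
  have "transpose E ** E = mat 1"
    using e by (simp add: E_def matrix_matrix_mult_def transpose_def mat_def vec_eq_iff
        orthonormal_family_def inner_vec_def)
  then have "det E \<noteq> 0"
    by (metis det_mul det_I mult_zero_right zero_neq_one)
  have "poly (charpoly A) x = poly (\<Prod>i\<in>UNIV. [:- \<mu> i, 1:]) x" for x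
  proof -
    define B where "B = (\<chi> i j. (if i = j then x else 0) - A $ i $ j)"
    define D where "D = (\<chi> i j::'n. if i = j then x - \<mu> j else 0)"
    have "(B ** E) $ i $ j = (E ** D) $ i $ j" for i j
    proof -
      have "(\<Sum>l\<in>UNIV. A $ i $ l * e j $ l) = \<mu> j * e j $ i"
        using arg_cong[OF eig[of j], of "\<lambda>v. v $ i"] by (simp add: matrix_vector_mult_def)
      then show ?thesis
        by (simp add: B_def D_def E_def matrix_matrix_mult_def left_diff_distrib sum_subtractf
            if_distrib[where f = "\<lambda>y. y * _"] if_distrib[where f = "\<lambda>y. _ * y"] algebra_simps cong: if_cong)
    qed
    then have "B ** E = E ** D"
      by (simp add: vec_eq_iff)
    then have "det B * det E = det E * det D"
      by (metis det_mul)
    then have "det B = det D"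
      using \<open>det E \<noteq> 0\<close> by simp
    also have "det D = (\<Prod>i\<in>UNIV. x - \<mu> i)"
      by (subst det_diagonal) (auto simp: D_def)
    finally show ?thesis
      by (simp add: poly_charpoly B_def poly_prod)
  qed
  then have "charpoly A = (\<Prod>i\<in>UNIV. [:- \<mu> i, 1:])"
    by (simp add: poly_eq_poly_eq_iff[symmetric] fun_eq_iff)
  then have "proots (charpoly A) = (\<Sum>i\<in>UNIV. {#\<mu> i#})"
    by (simp add: proots_prod)
  then show ?thesis
    by (simp add: sum_unfold_sum_mset)
qed

text \<open>The form in which the spectral theorem is applied below: the eigenvectors are numbered in the order of the
sorted list of eigenvalues. They are found first without regard to order and then listed by
increasing eigenvalue.\<close>

lemma symmetric_matrix_sorted_eigenbasis:
  fixes A :: "real^'n::finite^'n"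
  assumes "transpose A = A"
  obtains e where "orthonormal_family {..<CARD('n)} e"
    and "\<And>i. i < CARD('n) \<Longrightarrow> A *v e i = (eigenvalues A ! i) *\<^sub>R e i"
    and "length (eigenvalues A) = CARD('n)" and "sorted (eigenvalues A)"
proof -
  have "inner (A *v x) y = inner x (A *v y)" for x y
    using dot_lmul_matrix[of x A y] assms by (metis inner_commute vector_transpose_matrix)
  then obtain c \<nu> where c: "orthonormal_family {..<CARD('n)} c"
    and \<nu>: "\<And>i. i < CARD('n) \<Longrightarrow> A *v c i = \<nu> i *\<^sub>R c i"
    using selfadjoint_orthonormal_eigenvectors[of "(*v) A" "CARD('n)"]
    by (auto simp: matrix_vector_mul_linear)
  obtain p :: "'n \<Rightarrow> nat" where p: "bij_betw p UNIV {..<CARD('n)}"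
    using ex_bij_betw_finite_nat[of "UNIV :: 'n set"] by (auto simp: atLeast0LessThan)
  define b where "b i = c (p i)" for i
  define \<mu> where "\<mu> i = \<nu> (p i)" for i
  have pi: "p i < CARD('n)" for i
    using p by (auto simp: bij_betw_def)
  have b: "orthonormal_family UNIV b"
    unfolding b_def using p by (intro orthonormal_family_reindex[OF c]) (auto simp: bij_betw_def)
  have \<mu>: "A *v b i = \<mu> i *\<^sub>R b i" for i
    by (simp add: b_def \<mu>_def \<nu> pi)
  obtain zs :: "'n list" where zs: "set zs = UNIV" "distinct zs"
    using finite_distinct_list[of "UNIV :: 'n set"] by auto
  define ys where "ys = sort_key \<mu> zs"
  have ys: "set ys = UNIV" "distinct ys" "sorted (map \<mu> ys)"
    using zs by (simp_all add: ys_def)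
  have len: "length ys = CARD('n)"
    using distinct_card[OF ys(2)] ys(1) by simp
  have "mset (map \<mu> ys) = proots (charpoly A)"
    using ys mset_set_set[OF ys(2)]
    by (simp add: proots_charpoly_orthonormal_eigenbasis[OF b \<mu>])
  then have ev: "eigenvalues A = map \<mu> ys"
    unfolding eigenvalues_def
    using ys(3) by (metis sorted_list_of_multiset_mset sorted_sort_id)
  show thesis
  proof (rule that[of "\<lambda>i. b (ys ! i)"])
    show "orthonormal_family {..<CARD('n)} (\<lambda>i. b (ys ! i))"
      using ys len by (intro orthonormal_family_reindex[OF b]) (auto simp: inj_on_nth)
  qed (simp_all add: ev len ys \<mu>)
qed

lemma trace_eq_sum_eigenvalues:
  fixes A :: "real^'n::finite^'n"
  assumes A: "transpose A = A"
  shows "(\<Sum>i\<in>UNIV. A $ i $ i) = sum_list (eigenvalues A)"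
proof -
  let ?L = "eigenvalues A"
  obtain e where e: "orthonormal_family {..<CARD('n)} e"
    and eig: "\<And>i. i < CARD('n) \<Longrightarrow> A *v e i = (?L ! i) *\<^sub>R e i"
    and len: "length ?L = CARD('n)"
    using symmetric_matrix_sorted_eigenbasis[OF A] by metis
  have "A $ i $ i = (\<Sum>j<CARD('n). ?L ! j * (e j $ i)\<^sup>2)" for i
  proof -
    have "axis i 1 = (\<Sum>j<CARD('n). e j $ i *\<^sub>R e j)"
      using orthonormal_family_expansion[of e "axis i 1"] e
      by (simp add: inner_axis' )
    then have "A *v axis i 1 = (\<Sum>j<CARD('n). e j $ i *\<^sub>R (?L ! j) *\<^sub>R e j)"
      by (simp add: linear_sum[OF matrix_vector_mul_linear] eig matrix_vector_mult_scaleR)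
    then have "(A *v axis i 1) $ i = (\<Sum>j<CARD('n). ?L ! j * (e j $ i)\<^sup>2)"
      by (simp add: power2_eq_square mult_ac)
    then show ?thesis
      by (simp add: matrix_vector_mul_component inner_axis)
  qed
  then have "(\<Sum>i\<in>UNIV. A $ i $ i) = (\<Sum>j<CARD('n). \<Sum>i\<in>UNIV. ?L ! j * (e j $ i)\<^sup>2)"
    by (simp add: sum.swap[of _ _ UNIV])
  also have "\<dots> = (\<Sum>j<CARD('n). ?L ! j * inner (e j) (e j))"
    by (simp add: sum_distrib_left inner_vec_def power2_eq_square)
  also have "\<dots> = sum_list ?L"
    by (simp add: orthonormal_familyD[OF e] sum_list_sum_nth len lessThan_atLeast0)
  finally show ?thesis .
qed

section \<open>Sums of the smallest eigenvalues\<close>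

text \<open>Weights between \<open>0\<close> and \<open>1\<close> of total mass \<open>m\<close> give the smallest weighted sum when they are
concentrated on the first \<open>m\<close> entries of the sorted list.\<close>

lemma sum_take_le_weighted_sum:
  fixes L :: "real list"
  assumes "sorted L" and "m < length L"
    and c: "\<And>i. i < length L \<Longrightarrow> 0 \<le> c i \<and> c i \<le> 1" and "(\<Sum>i<length L. c i) = real m"
  shows "sum_list (take m L) \<le> (\<Sum>i<length L. L ! i * c i)"
proof -
  have split: "(\<Sum>i<length L. h i) = (\<Sum>i<m. h i) + (\<Sum>i\<in>{m..<length L}. h i)" for h :: "nat \<Rightarrow> real"
    using \<open>m < length L\<close> by (metis lessThan_atLeast0 less_imp_le sum.atLeastLessThan_concat zero_le)
  have take: "sum_list (take m L) = (\<Sum>i<m. L ! i)"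
    using \<open>m < length L\<close> by (simp add: sum_list_sum_nth lessThan_atLeast0)
  \<comment> \<open>The deviations of the weights from the optimal ones add up to \<open>0\<close>. The entry \<open>L ! m\<close> separates
    the entries whose weight can only have dropped from those whose weight can only have grown.\<close>
  have "0 = (\<Sum>i<length L. L ! m * c i) - L ! m * m"
    using assms(4) by (simp add: sum_distrib_left[symmetric])
  also have "\<dots> = (\<Sum>i<m. L ! m * (c i - 1)) + (\<Sum>i\<in>{m..<length L}. L ! m * c i)"
    by (simp add: split algebra_simps sum.distrib sum_subtractf)
  also have "\<dots> \<le> (\<Sum>i<m. L ! i * (c i - 1)) + (\<Sum>i\<in>{m..<length L}. L ! i * c i)"
  proof (intro add_mono sum_mono)
    fix i assume "i \<in> {..<m}"
    then show "L ! m * (c i - 1) \<le> L ! i * (c i - 1)"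
      using c[of i] assms(1,2) by (intro mult_right_mono_neg sorted_nth_mono) auto
  next
    fix i assume "i \<in> {m..<length L}"
    then show "L ! m * c i \<le> L ! i * c i"
      using c[of i] assms(1,2) by (intro mult_right_mono sorted_nth_mono) auto
  qed
  also have "\<dots> = (\<Sum>i<length L. L ! i * c i) - sum_list (take m L)"
    by (simp add: split take algebra_simps sum_subtractf)
  finally show ?thesis
    by simp
qed

text \<open>Ky Fan's minimum principle. In an eigenbasis \<open>e\<close>, the sum of the \<open>\<langle>w\<^sub>l, A w\<^sub>l\<rangle>\<close> is a weighted sum of the
eigenvalues with weights \<open>c\<^sub>i = \<Sum>l. \<langle>w\<^sub>l, e\<^sub>i\<rangle>\<^sup>2\<close>. Bessel's inequality for the family \<open>w\<close> gives
\<open>c\<^sub>i \<le> 1\<close>, and Parseval's identity for the basis \<open>e\<close> shows that the weights have total mass \<open>m\<close>.\<close>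

theorem ky_fan_lower_bound:
  fixes A :: "real^'n::finite^'n"
  assumes A: "transpose A = A" and w: "orthonormal_family {..<m} w" and "m < CARD('n)"
  shows "sum_smallest_eigenvalues m A \<le> (\<Sum>l<m. inner (w l) (A *v w l))"
proof -
  let ?L = "eigenvalues A"
  obtain e where e: "orthonormal_family {..<CARD('n)} e"
    and eig: "\<And>i. i < CARD('n) \<Longrightarrow> A *v e i = (?L ! i) *\<^sub>R e i"
    and len: "length ?L = CARD('n)" and sorted: "sorted ?L"
    using symmetric_matrix_sorted_eigenbasis[OF A] by metis
  define c where "c i = (\<Sum>l<m. (inner (w l) (e i))\<^sup>2)" for i
  have form: "inner x (A *v x) = (\<Sum>i<CARD('n). ?L ! i * (inner x (e i))\<^sup>2)" for x
  proof -
    have "A *v x = A *v (\<Sum>i<CARD('n). inner x (e i) *\<^sub>R e i)"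
      using orthonormal_family_expansion[of e x] e by simp
    also have "\<dots> = (\<Sum>i<CARD('n). inner x (e i) *\<^sub>R (?L ! i) *\<^sub>R e i)"
      by (simp add: linear_sum[OF matrix_vector_mul_linear] eig matrix_vector_mult_scaleR)
    finally show ?thesis
      by (simp add: inner_sum_right power2_eq_square mult_ac)
  qed
  have "c i \<le> 1" if "i < CARD('n)" for i
    using bessel_inequality[OF _ w, of "e i"] orthonormal_familyD[OF e, of i i] that
    by (simp add: c_def inner_commute)
  moreover have "(\<Sum>i<CARD('n). c i) = m"
    unfolding c_def using orthonormal_family_parseval[of e] e w
    by (subst sum.swap) (simp add: orthonormal_familyD)
  ultimately have "sum_list (take m ?L) \<le> (\<Sum>i<CARD('n). ?L ! i * c i)"
    using sum_take_le_weighted_sum[OF sorted, of m c] \<open>m < CARD('n)\<close>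
    by (simp add: len c_def sum_nonneg)
  also have "\<dots> = (\<Sum>l<m. inner (w l) (A *v w l))"
    by (simp add: form c_def sum_distrib_left) (rule sum.swap)
  finally show ?thesis
    by (simp add: sum_smallest_eigenvalues_def)
qed

section \<open>Low-rank approximation of a finite family of vectors\<close>

text \<open>As a map of the coefficient vector, this is the adjoint of \<open>\<phi> \<mapsto> (\<langle>h\<^sub>i, \<phi>\<rangle>)\<^sub>i\<close>.\<close>

definition vec_combination :: "('n::finite \<Rightarrow> 'h::real_inner) \<Rightarrow> real^'n \<Rightarrow> 'h" where
  "vec_combination h v = (\<Sum>i\<in>UNIV. v $ i *\<^sub>R h i)"

definition gram_matrix :: "('n::finite \<Rightarrow> 'h::real_inner) \<Rightarrow> real^'n^'n" where
  "gram_matrix h = (\<chi> i j. inner (h i) (h j))"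

lemma gram_matrix_symmetric: "transpose (gram_matrix h) = gram_matrix h"
  by (simp add: gram_matrix_def transpose_def vec_eq_iff inner_commute)

lemma gram_matrix_mult: "(gram_matrix h *v v) $ i = inner (h i) (vec_combination h v)"
  by (simp add: gram_matrix_def vec_combination_def matrix_vector_mult_def inner_sum_right mult_ac)

lemma norm_vec_combination:
  "(norm (vec_combination h v))\<^sup>2 = inner v (gram_matrix h *v v)"
proof -
  have "inner v (gram_matrix h *v v) = (\<Sum>i\<in>UNIV. v $ i * inner (h i) (vec_combination h v))"
    by (simp add: inner_vec_def gram_matrix_mult)
  then show ?thesis
    by (simp add: power2_norm_eq_inner)
       (simp add: vec_combination_def inner_sum_left)
qed

text \<open>Pythagoras' theorem for the Hilbert-Schmidt norm. If \<open>P\<close> is the orthogonal projection of \<open>\<real>\<^sup>n\<close> onto the span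
of the \<open>w\<^sub>l\<close>, and \<open>H\<close> is the operator with rows \<open>h\<^sub>i\<close>, the identity reads
\<open>\<parallel>H - P H\<parallel>\<^sup>2 = \<parallel>H\<parallel>\<^sup>2 - \<parallel>P H\<parallel>\<^sup>2\<close>. It yields the lower bound for all operators of low rank, because the
left-hand side is nonnegative, and also the exact error of the eigenprojection.\<close>

lemma sum_norm_residual:
  fixes h :: "'n::finite \<Rightarrow> 'h::real_inner"
  assumes "finite I" and w: "orthonormal_family I w"
  shows "(\<Sum>i\<in>UNIV. (norm (h i - (\<Sum>l\<in>I. w l $ i *\<^sub>R vec_combination h (w l))))\<^sup>2)
    = (\<Sum>i\<in>UNIV. (norm (h i))\<^sup>2) - (\<Sum>l\<in>I. (norm (vec_combination h (w l)))\<^sup>2)"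
proof -
  let ?c = "\<lambda>l. vec_combination h (w l)"
  let ?p = "\<lambda>i. \<Sum>l\<in>I. w l $ i *\<^sub>R ?c l"
  have hp: "(\<Sum>i\<in>UNIV. inner (h i) (?p i)) = (\<Sum>l\<in>I. (norm (?c l))\<^sup>2)"
  proof -
    have "(\<Sum>i\<in>UNIV. inner (h i) (?p i)) = (\<Sum>l\<in>I. \<Sum>i\<in>UNIV. w l $ i * inner (h i) (?c l))"
      by (simp add: inner_sum_right) (rule sum.swap)
    also have "\<dots> = (\<Sum>l\<in>I. inner (\<Sum>i\<in>UNIV. w l $ i *\<^sub>R h i) (?c l))"
      by (simp add: inner_sum_left)
    finally show ?thesis
      by (simp add: vec_combination_def power2_norm_eq_inner)
  qed
  have pp: "(\<Sum>i\<in>UNIV. inner (?p i) (?p i)) = (\<Sum>l\<in>I. (norm (?c l))\<^sup>2)"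
  proof -
    have "(\<Sum>i\<in>UNIV. inner (?p i) (?p i))
        = (\<Sum>i\<in>UNIV. \<Sum>l\<in>I. \<Sum>j\<in>I. w l $ i * w j $ i * inner (?c l) (?c j))"
      by (simp add: inner_sum_left inner_sum_right sum_distrib_left mult_ac
          inner_commute[of "vec_combination h _" "vec_combination h _"])
    also have "\<dots> = (\<Sum>l\<in>I. \<Sum>j\<in>I. \<Sum>i\<in>UNIV. w l $ i * w j $ i * inner (?c l) (?c j))"
      by (subst sum.swap) (rule sum.cong[OF refl], rule sum.swap)
    also have "\<dots> = (\<Sum>l\<in>I. \<Sum>j\<in>I. inner (w l) (w j) * inner (?c l) (?c j))"
      by (simp add: inner_vec_def sum_distrib_right)
    also have "\<dots> = (\<Sum>l\<in>I. (norm (?c l))\<^sup>2)"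
      using \<open>finite I\<close>
      by (simp add: orthonormal_familyD[OF w] power2_norm_eq_inner if_distrib[where f = "\<lambda>y. y * _"]
          cong: if_cong)
    finally show ?thesis .
  qed
  have "(\<Sum>i\<in>UNIV. (norm (h i - ?p i))\<^sup>2)
      = (\<Sum>i\<in>UNIV. (norm (h i))\<^sup>2) - 2 * (\<Sum>i\<in>UNIV. inner (h i) (?p i)) + (\<Sum>i\<in>UNIV. inner (?p i) (?p i))"
    by (simp add: power2_norm_eq_inner inner_diff_left inner_diff_right inner_commute[of "?p _" "h _"]
        sum.distrib sum_subtractf sum_distrib_left algebra_simps)
  then show ?thesis
    by (simp only: hp pp)
qed

text \<open>The vectors \<open>w\<^sub>l\<close> stand for an orthonormal family in the orthogonal complement of the range of the
approximating operator. In these directions the operator makes no contribution, and the whole of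
\<open>g\<close> is lost.\<close>

lemma eckart_young_lower_bound:
  fixes g s :: "'n::finite \<Rightarrow> 'h::real_inner"
  assumes w: "orthonormal_family {..<m} w" and "m < CARD('n)"
    and zero: "\<And>l. l < m \<Longrightarrow> vec_combination s (w l) = 0"
  shows "sum_smallest_eigenvalues m (gram_matrix g) \<le> (\<Sum>i\<in>UNIV. (norm (g i - s i))\<^sup>2)"
proof -
  let ?h = "\<lambda>i. g i - s i"
  have "vec_combination ?h (w l) = vec_combination g (w l)" if "l < m" for l
    using zero[OF that] by (simp add: vec_combination_def algebra_simps sum_subtractf)
  then have "(\<Sum>l<m. (norm (vec_combination ?h (w l)))\<^sup>2) = (\<Sum>l<m. inner (w l) (gram_matrix g *v w l))"
    by (simp add: norm_vec_combination[symmetric])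
  moreover have "0 \<le> (\<Sum>i\<in>UNIV. (norm (?h i))\<^sup>2) - (\<Sum>l<m. (norm (vec_combination ?h (w l)))\<^sup>2)"
    unfolding sum_norm_residual[OF finite_lessThan w, of ?h, symmetric] by (simp add: sum_nonneg)
  ultimately show ?thesis
    using ky_fan_lower_bound[OF gram_matrix_symmetric w \<open>m < CARD('n)\<close>, of g] by simp
qed

text \<open>The total \<open>\<Sum>i. \<parallel>g\<^sub>i\<parallel>\<^sup>2\<close> is the trace of the Gram matrix, hence the sum of all eigenvalues, and the
projection accounts for the \<open>k\<close> largest of them.\<close>

lemma top_eigenvectors_residual:
  fixes g :: "'n::finite \<Rightarrow> 'h::real_inner"
  assumes u: "top_eigenvectors k (gram_matrix g) u" and "k \<le> CARD('n)"
  shows "(\<Sum>i\<in>UNIV. (norm (g i - (\<Sum>l<k. u l $ i *\<^sub>R vec_combination g (u l))))\<^sup>2)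
    = sum_smallest_eigenvalues (CARD('n) - k) (gram_matrix g)"
proof -
  let ?A = "gram_matrix g" and ?L = "eigenvalues (gram_matrix g)"
  have orth: "orthonormal_family {..<k} u"
    and eig: "\<And>l. l < k \<Longrightarrow> ?A *v u l = (rev ?L ! l) *\<^sub>R u l"
    using u by (simp_all add: top_eigenvectors_def orthonormal_family_def)
  have len: "length ?L = CARD('n)"
    using symmetric_matrix_sorted_eigenbasis[OF gram_matrix_symmetric] by metis
  have "(\<Sum>l<k. (norm (vec_combination g (u l)))\<^sup>2) = (\<Sum>l<k. rev ?L ! l)"
    by (simp add: norm_vec_combination eig orthonormal_familyD[OF orth])
  also have "\<dots> = sum_list (take k (rev ?L))"
    using \<open>k \<le> CARD('n)\<close> by (simp add: sum_list_sum_nth len lessThan_atLeast0)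
  also have "\<dots> = sum_list (drop (CARD('n) - k) ?L)"
    by (simp add: take_rev len)
  finally have top: "(\<Sum>l<k. (norm (vec_combination g (u l)))\<^sup>2) = sum_list (drop (CARD('n) - k) ?L)" .
  have "(\<Sum>i\<in>UNIV. (norm (g i))\<^sup>2) = (\<Sum>i\<in>UNIV. ?A $ i $ i)"
    by (simp add: gram_matrix_def power2_norm_eq_inner)
  also have "\<dots> = sum_list (take (CARD('n) - k) ?L) + sum_list (drop (CARD('n) - k) ?L)"
    by (simp add: trace_eq_sum_eigenvalues[OF gram_matrix_symmetric] sum_list_append[symmetric]
        del: sum_list_append)
  finally show ?thesis
    unfolding sum_norm_residual[OF finite_lessThan orth] top
    by (simp add: sum_smallest_eigenvalues_def)
qed

lemma top_eigenvectors_exist: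
  fixes A :: "real^'n::finite^'n"
  assumes "transpose A = A" and "k \<le> CARD('n)"
  shows "\<exists>u. top_eigenvectors k A u"
proof -
  obtain e where e: "orthonormal_family {..<CARD('n)} e"
    and eig: "\<And>i. i < CARD('n) \<Longrightarrow> A *v e i = (eigenvalues A ! i) *\<^sub>R e i"
    and len: "length (eigenvalues A) = CARD('n)"
    using symmetric_matrix_sorted_eigenbasis[OF assms(1)] by metis
  have "top_eigenvectors k A (\<lambda>i. e (CARD('n) - Suc i))"
    using \<open>k \<le> CARD('n)\<close>
    by (auto simp: top_eigenvectors_def orthonormal_familyD[OF e] eig rev_nth len)
  then show ?thesis
    by blast
qed

section \<open>Operators from the function space to a finite-dimensional space\<close>

lemma operator_of_nth: "operator_of h \<phi> $ i = inner (h i) \<phi>"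
  by (simp add: operator_of_def inner_l2_def)

lemma inner_operator_of: "inner (operator_of h \<phi>) v = inner \<phi> (vec_combination h v)"
  by (simp add: inner_vec_def operator_of_nth vec_combination_def inner_sum_right inner_commute mult_ac)

lemma adjoint_operator_of: "adjoint (operator_of h) = vec_combination h"
  by (rule adjoint_unique) (simp add: inner_operator_of)

lemma bounded_linear_operator_of: "bounded_linear (operator_of h)"
proof -
  have sum: "operator_of h = (\<lambda>\<phi>. \<Sum>i\<in>UNIV. inner (h i) \<phi> *\<^sub>R axis i 1)"
    by (simp add: fun_eq_iff vec_eq_iff operator_of_nth axis_def
        if_distrib[where f = "\<lambda>y. _ * y"] cong: if_cong)
  show ?thesis
    unfolding sum
    by (rule bounded_linear_sum, rule bounded_linear_scaleR_const, rule bounded_linear_inner_right)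
qed

lemma component_operator_of: "component (operator_of h) = h"
proof
  fix i
  show "component (operator_of h) i = h i"
    unfolding component_def operator_of_nth inner_l2_def[symmetric]
  proof (rule the_equality)
    fix h'
    assume "\<forall>\<phi>. inner (h i) \<phi> = inner h' \<phi>"
    then show "h' = h i"
      using vector_eq_rdot[of h' "h i"] by metis
  qed simp
qed

text \<open>The description by \<open>THE\<close> in \<open>component\<close> is meaningful because a representing function exists by the
Riesz representation; this is the place where completeness of the function space enters. It makes the
Hilbert-Schmidt norm of every bounded operator computable from its components.\<close>

lemma operator_of_component:
  assumes "bounded_linear S"
  shows "operator_of (component S) = S"
proof -
  have "\<exists>h. \<forall>\<phi>. S \<phi> $ i = inner h \<phi>" for i
    by (rule riesz_representation[OF bounded_linear_compose[OF bounded_linear_vec_nth assms], of i]) blast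
  then obtain h where "\<And>i \<phi>. S \<phi> $ i = inner (h i) \<phi>"
    by metis
  then have "S = operator_of h"
    by (simp add: fun_eq_iff vec_eq_iff operator_of_nth)
  then show ?thesis
    by (simp add: component_operator_of)
qed

lemma hs_norm_operator_of_diff:
  "(hs_norm (\<lambda>\<phi>. operator_of g \<phi> - operator_of s \<phi>))\<^sup>2 = (\<Sum>i\<in>UNIV. (norm (g i - s i))\<^sup>2)"
proof -
  have "(\<lambda>\<phi>. operator_of g \<phi> - operator_of s \<phi>) = operator_of (\<lambda>i. g i - s i)"
    by (simp add: fun_eq_iff vec_eq_iff operator_of_nth inner_diff_left)
  then show ?thesis
    by (simp add: hs_norm_def component_operator_of sum_nonneg)
qed

text \<open>The range of \<open>S\<close> has dimension at most \<open>k\<close>, so its orthogonal complement contains \<open>n - k\<close> orthonormal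
vectors, and the adjoint of \<open>S\<close> annihilates them.\<close>

lemma hs_norm_lower_bound:
  fixes g :: "'n::finite \<Rightarrow> 'a::euclidean_space l2"
  assumes S: "bounded_linear S" and rank: "dim (range S) \<le> k" and "1 \<le> k"
  shows "sum_smallest_eigenvalues (CARD('n) - k) (gram_matrix g)
    \<le> (hs_norm (\<lambda>\<phi>. operator_of g \<phi> - S \<phi>))\<^sup>2"
proof -
  define V where "V = range S"
  define W where "W = {y \<in> UNIV. \<forall>x\<in>V. orthogonal x y}"
  have V: "subspace V"
    unfolding V_def by (intro linear_subspace_image bounded_linear.linear[OF S] subspace_UNIV)
  have "dim W + dim V = CARD('n)"
    using dim_subspace_orthogonal_to_vectors[OF V subspace_UNIV] by (simp add: W_def)
  then have "CARD('n) - k \<le> dim W"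
    using rank by (simp add: V_def)
  moreover have "subspace W"
    using subspace_orthogonal_to_vectors by (simp add: W_def)
  ultimately obtain w where w: "orthonormal_family {..<CARD('n) - k} w"
    and wW: "\<And>l. l < CARD('n) - k \<Longrightarrow> w l \<in> W"
    using orthonormal_family_in_subspace by metis
  define s where "s = component S"
  have s: "S = operator_of s"
    by (simp add: s_def operator_of_component[OF S])
  have "vec_combination s (w l) = 0" if "l < CARD('n) - k" for l
  proof -
    have "inner \<phi> (vec_combination s (w l)) = 0" for \<phi>
      using wW[OF that] by (simp add: W_def V_def s orthogonal_def inner_operator_of[symmetric])
    then show ?thesis
      by (metis inner_eq_zero_iff)
  qed
  moreover have "CARD('n) - k < CARD('n)"
    using \<open>1 \<le> k\<close> by simp
  ultimately show ?thesis
    unfolding s hs_norm_operator_of_diff by (intro eckart_young_lower_bound[OF w])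
qed

lemma eigenprojection_mult: "eigenprojection k u *v y = (\<Sum>l<k. inner (u l) y *\<^sub>R u l)"
  unfolding eigenprojection_def
  by (simp add: vec_eq_iff matrix_vector_mult_def inner_vec_def sum_component sum_distrib_right
      sum_distrib_left mult_ac) (auto intro: sum.swap)

lemma eigenprojection_operator_of:
  "(\<lambda>\<phi>. eigenprojection k u *v operator_of g \<phi>)
    = operator_of (\<lambda>i. \<Sum>l<k. u l $ i *\<^sub>R vec_combination g (u l))"
proof -
  have "inner (u l) (operator_of g \<phi>) = inner (vec_combination g (u l)) \<phi>" for l \<phi>
    by (metis inner_commute inner_operator_of)
  then show ?thesis
    by (simp add: fun_eq_iff vec_eq_iff eigenprojection_mult operator_of_nth inner_sum_left mult_ac)
qed

lemma dim_range_eigenprojection_le: "dim (range (\<lambda>\<phi>. eigenprojection k u *v T \<phi>)) \<le> k"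
proof -
  have "range (\<lambda>\<phi>. eigenprojection k u *v T \<phi>) \<subseteq> span (u ` {..<k})"
    unfolding eigenprojection_mult
    by (intro image_subsetI span_sum span_scale) (simp add: span_base)
  then have "dim (range (\<lambda>\<phi>. eigenprojection k u *v T \<phi>)) \<le> card (u ` {..<k})"
    by (intro dim_le_card) simp_all
  then show ?thesis
    using card_image_le[of "{..<k}" u] by simp
qed

lemma kernel_matrix_eq_gram_matrix:
  assumes "sqrt_kernel_family M f g"
  shows "kernel_matrix M f = gram_matrix g"
  using assms
  by (simp add: sqrt_kernel_family_def kernel_matrix_def gram_matrix_def inner_l2_def vec_eq_iff)

section \<open>Optimal low-rank approximation\<close>

theorem theorem8:
  fixes M :: "real^'n \<Rightarrow> real^'n \<Rightarrow> complex"
    and f :: "real^'n::finite \<Rightarrow> complex"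
    and g :: "'n \<Rightarrow> (real^'n) l2"
    and k :: nat
  assumes "1 \<le> k" and "k \<le> CARD('n)"
    and "mercer_kernel M"
    and "densely_defined (kernel_operator M)"
    and "finite_trace M f"
    and "sqrt_kernel_family M f g"
  shows "bounded_linear (operator_of g)
    \<and> operator_of g \<circ> adjoint (operator_of g) = (*v) (kernel_matrix M f)
    \<and> (\<exists>S. is_arg_min (\<lambda>S. (hs_norm (\<lambda>\<phi>. operator_of g \<phi> - S \<phi>))\<^sup>2)
               (\<lambda>S. bounded_linear S \<and> dim (range S) \<le> k) S
           \<and> (hs_norm (\<lambda>\<phi>. operator_of g \<phi> - S \<phi>))\<^sup>2 = error_functional M k f)
    \<and> (\<forall>u. top_eigenvectors k (kernel_matrix M f) u \<longrightarrow>
           is_arg_min (\<lambda>S. (hs_norm (\<lambda>\<phi>. operator_of g \<phi> - S \<phi>))\<^sup>2)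
             (\<lambda>S. bounded_linear S \<and> dim (range S) \<le> k)
             (\<lambda>\<phi>. eigenprojection k u *v operator_of g \<phi>))"
proof -
  let ?F = "\<lambda>S. (hs_norm (\<lambda>\<phi>. operator_of g \<phi> - S \<phi>))\<^sup>2"
  let ?feasible = "\<lambda>S :: (real^'n) l2 \<Rightarrow> real^'n. bounded_linear S \<and> dim (range S) \<le> k"
  let ?P = "\<lambda>u \<phi>. eigenprojection k u *v operator_of g \<phi>"
  have gram: "kernel_matrix M f = gram_matrix g"
    by (rule kernel_matrix_eq_gram_matrix) fact
  have product: "operator_of g \<circ> adjoint (operator_of g) = (*v) (kernel_matrix M f)"
    by (simp add: fun_eq_iff vec_eq_iff adjoint_operator_of operator_of_nth gram gram_matrix_mult)
  have lower: "error_functional M k f \<le> ?F S" if "?feasible S" for S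
    using that hs_norm_lower_bound[of S k g] \<open>1 \<le> k\<close>
    by (simp add: error_functional_def gram)
  have attained: "?F (?P u) = error_functional M k f" if "top_eigenvectors k (kernel_matrix M f) u" for u
    using top_eigenvectors_residual[of k g u] that \<open>k \<le> CARD('n)\<close>
    by (simp add: error_functional_def gram fun_cong[OF eigenprojection_operator_of]
        hs_norm_operator_of_diff)
  have optimal: "is_arg_min ?F ?feasible (?P u)" if u: "top_eigenvectors k (kernel_matrix M f) u" for u
  proof -
    have "bounded_linear (?P u)"
      unfolding eigenprojection_operator_of by (rule bounded_linear_operator_of)
    then show ?thesis
      unfolding is_arg_min_def attained[OF u]
      using lower dim_range_eigenprojection_le[of k u "operator_of g"] by (auto simp: not_less)
  qed
  obtain u where "top_eigenvectors k (kernel_matrix M f) u"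
    using top_eigenvectors_exist[of "gram_matrix g" k] gram_matrix_symmetric \<open>k \<le> CARD('n)\<close>
    by (auto simp: gram)
  then have "is_arg_min ?F ?feasible (?P u) \<and> ?F (?P u) = error_functional M k f"
    using optimal attained by blast
  then show ?thesis
    using bounded_linear_operator_of product optimal by blast
qed

end
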